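(* Let $\Delta$ be a dual net which is not a dual affine plane. If $\Delta$ satisfies (VY), then $\Delta$ satisfies (LD).
   Context: A dual net is an incidence structure of points and lines (blocks) in which any two distinct points lie on at most one common line, and such that for every point $z$ and every line $B$ not containing $z$ there is a unique point of $B$ not collinear with $z$ (with the usual nondegeneracy: every line has at least two points, etc.). It is a dual affine plane if any two distinct lines meet in a point. Distinct noncollinear points are called parallel; "equal or parallel" is an equivalence relation whose classes are called vertical lines. Adjoining a new point $\infty$ incident with all vertical lines yields a linear space $\overline{\Delta}$ whose lines are the lines of $\Delta$ and the vertical lines. A triangle is a set of three distinct lines of $\Delta$ pairwise meeting in three distinct points (its vertices). Two triangles are in perspective from $\infty$ if there are three distinct vertical lines each containing exactly one vertex of each triangle; this defines a correspondence between vertices and hence between sides. (VY): if a line of $\Delta$ meets two sides of a triangle in two distinct points, then it meets the third side as well. (LD): for every pair of triangles in perspective from $\infty$ for which two pairs of corresponding sides meet in points of one vertical line $V$, the third pair of corresponding sides also meets in a point of $V$.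
   Formalization: In (LD), the two given pairs of corresponding sides are required to meet in two distinct points of V; without this (LD) fails when the two triangles share a vertex, e.g. for the points and lines of a projective 3-space off a fixed line. *)

theory Defs
  imports Main
begin

(* A line is identified with the set of its points. This loses no generality: every line has two
   points, and two points lie on at most one line. *)

definition collinear :: "'p set set \<Rightarrow> 'p \<Rightarrow> 'p \<Rightarrow> bool" where
  "collinear L x y \<longleftrightarrow> (\<exists>B\<in>L. x \<in> B \<and> y \<in> B)"

(* No further nondegeneracy is assumed. If there are two disjoint lines, that is, if the dual net is
   not a dual affine plane, the axioms already force every point to lie on at least two lines. *)
locale dual_net =
  fixes P :: "'p set" and L :: "'p set set"
  assumes lines_subset: "B \<in> L \<Longrightarrow> B \<subseteq> P"
    and two_points: "B \<in> L \<Longrightarrow> \<exists>x\<in>B. \<exists>y\<in>B. x \<noteq> y"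
    and line_unique:
      "\<lbrakk>B \<in> L; C \<in> L; x \<in> B; y \<in> B; x \<in> C; y \<in> C; x \<noteq> y\<rbrakk> \<Longrightarrow> B = C"
    and unique_noncollinear:
      "\<lbrakk>z \<in> P; B \<in> L; z \<notin> B\<rbrakk> \<Longrightarrow> \<exists>!y. y \<in> B \<and> \<not> collinear L z y"

definition dual_affine_plane :: "'p set \<Rightarrow> 'p set set \<Rightarrow> bool" where
  "dual_affine_plane P L \<longleftrightarrow>
     dual_net P L \<and> (\<forall>A\<in>L. \<forall>B\<in>L. A \<noteq> B \<longrightarrow> (\<exists>p. p \<in> A \<and> p \<in> B))"

definition parallel :: "'p set set \<Rightarrow> 'p \<Rightarrow> 'p \<Rightarrow> bool" where
  "parallel L x y \<longleftrightarrow> x \<noteq> y \<and> \<not> collinear L x y"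

definition vertical_lines :: "'p set \<Rightarrow> 'p set set \<Rightarrow> 'p set set" where
  "vertical_lines P L = P // {(x, y). x \<in> P \<and> y \<in> P \<and> (x = y \<or> parallel L x y)}"

definition vertices :: "'p set set \<Rightarrow> 'p set" where
  "vertices T = {x. \<exists>A\<in>T. \<exists>B\<in>T. A \<noteq> B \<and> x \<in> A \<and> x \<in> B}"

definition triangle :: "'p set set \<Rightarrow> 'p set set \<Rightarrow> bool" where
  "triangle L T \<longleftrightarrow> T \<subseteq> L \<and> card T = 3 \<and>
     (\<forall>A\<in>T. \<forall>B\<in>T. A \<noteq> B \<longrightarrow> A \<inter> B \<noteq> {}) \<and> card (vertices T) = 3"

definition in_perspective :: "'p set \<Rightarrow> 'p set set \<Rightarrow> 'p set set \<Rightarrow> 'p set set \<Rightarrow> bool" where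
  "in_perspective P L T T' \<longleftrightarrow> triangle L T \<and> triangle L T' \<and>
     (\<exists>W. W \<subseteq> vertical_lines P L \<and> card W = 3 \<and>
        (\<forall>V\<in>W. (\<exists>!v. v \<in> vertices T \<and> v \<in> V) \<and> (\<exists>!v. v \<in> vertices T' \<and> v \<in> V)))"

(* For triangles in perspective, corresponding vertices are those on a common vertical line.
   The three vertical lines of the perspectivity need not be named: they are the only ones that
   contain a vertex. *)
definition corresponding_vertices ::
    "'p set \<Rightarrow> 'p set set \<Rightarrow> 'p set set \<Rightarrow> 'p set set \<Rightarrow> 'p \<Rightarrow> 'p \<Rightarrow> bool" where
  "corresponding_vertices P L T T' v v' \<longleftrightarrow>
     v \<in> vertices T \<and> v' \<in> vertices T' \<and> (\<exists>V\<in>vertical_lines P L. v \<in> V \<and> v' \<in> V)"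

definition corresponding_sides ::
    "'p set \<Rightarrow> 'p set set \<Rightarrow> 'p set set \<Rightarrow> 'p set set \<Rightarrow> 'p set \<Rightarrow> 'p set \<Rightarrow> bool" where
  "corresponding_sides P L T T' A A' \<longleftrightarrow> A \<in> T \<and> A' \<in> T' \<and>
     (\<forall>v v'. corresponding_vertices P L T T' v v' \<longrightarrow> (v \<in> A \<longleftrightarrow> v' \<in> A'))"

definition VY :: "'p set set \<Rightarrow> bool" where
  "VY L \<longleftrightarrow> (\<forall>A B C M x y.
     triangle L {A, B, C} \<and> M \<in> L \<and> x \<in> M \<and> x \<in> A \<and> y \<in> M \<and> y \<in> B \<and> x \<noteq> y
       \<longrightarrow> (\<exists>z. z \<in> M \<and> z \<in> C))"

(* The two given pairs of sides are required to meet in two distinct points p, q of V. If the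
   triangles have no common vertex, p \<noteq> q is automatic. The condition only excludes
   the degenerate case in which p = q is a common vertex of both triangles; there the conclusion
   fails already for the points and lines of a projective 3-space off a fixed line. *)
definition LD :: "'p set \<Rightarrow> 'p set set \<Rightarrow> bool" where
  "LD P L \<longleftrightarrow> (\<forall>A B C A' B' C' V p q.
     in_perspective P L {A, B, C} {A', B', C'} \<and>
     corresponding_sides P L {A, B, C} {A', B', C'} A A' \<and>
     corresponding_sides P L {A, B, C} {A', B', C'} B B' \<and>
     corresponding_sides P L {A, B, C} {A', B', C'} C C' \<and>
     V \<in> vertical_lines P L \<and> p \<in> V \<and> q \<in> V \<and> p \<noteq> q \<and>
     p \<in> A \<and> p \<in> A' \<and> q \<in> B \<and> q \<in> B'
       \<longrightarrow> (\<exists>r\<in>V. r \<in> C \<and> r \<in> C'))"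

end

theory Submission
  imports Defs
begin

text \<open>Axiom (VY) makes any two intersecting lines span a plane, a family of pairwise intersecting lines
  closed under joining nonparallel points. Two planes that share two parallel points share their whole
  trace on the vertical line of these points. This gives Desargues' theorem for triangles in different
  planes. Two disjoint lines cannot lie in one plane, so there are points off any plane, and the case
  of coplanar triangles follows by comparison with a third triangle outside their plane.\<close>

text \<open>The picture behind the constructions is a projective space with a subspace of
  codimension two removed. The lines are those that miss this subspace, two points are parallel when
  their projective join meets it, and the vertical lines are the hyperplanes through it with the
  subspace deleted. A plane meets the subspace in one point, and its vertical traces come from the
  projective lines through that point; hence two points fix a trace. The obstacle is that parallel
  points have no join in \<open>L\<close>. Each auxiliary line of the classical space arguments
  therefore needs a proof that two points are not parallel, and points are chosen off prescribed
  vertical lines to secure this. The room for such choices comes from three mutually nonparallel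
  points, supplied in the end by the vertices of a triangle.\<close>

context dual_net
begin

section \<open>Parallelism and joins\<close>

definition par :: "'p \<Rightarrow> 'p \<Rightarrow> bool" where
  "par x y \<longleftrightarrow> x = y \<or> parallel L x y"

lemma par_refl [simp]: "par x x"
  by (simp add: par_def)

lemma par_sym: "par x y \<Longrightarrow> par y x"
  by (auto simp: par_def parallel_def collinear_def)

lemma line_eqI: "\<lbrakk>B \<in> L; C \<in> L; x \<in> B; x \<in> C; y \<in> B; y \<in> C; x \<noteq> y\<rbrakk> \<Longrightarrow> B = C"
  by (rule line_unique)

lemma meet_eqI: "\<lbrakk>B \<in> L; C \<in> L; B \<noteq> C; x \<in> B; x \<in> C; y \<in> B; y \<in> C\<rbrakk> \<Longrightarrow> x = y"
  using line_unique by blast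

lemma in_P: "\<lbrakk>B \<in> L; x \<in> B\<rbrakk> \<Longrightarrow> x \<in> P"
  using lines_subset by blast

lemma par_on_line: "\<lbrakk>B \<in> L; x \<in> B; y \<in> B; par x y\<rbrakk> \<Longrightarrow> x = y"
  by (auto simp: par_def parallel_def collinear_def)

lemma join: "\<not> par x y \<Longrightarrow> \<exists>B\<in>L. x \<in> B \<and> y \<in> B"
  by (auto simp: par_def parallel_def collinear_def)

lemma par_point:
  assumes "B \<in> L" "x \<in> P"
  shows "\<exists>y\<in>B. par x y"
  using unique_noncollinear[OF assms(2,1)] by (auto simp: par_def parallel_def)

text \<open>A line through \<open>x\<close> and \<open>z\<close> would carry two points not
  collinear with \<open>y\<close>. The middle point must lie in \<open>P\<close> because
  \<open>par\<close> itself does not restrict its arguments to \<open>P\<close>.\<close>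

lemma par_trans:
  assumes "par x y" "par y z" "y \<in> P"
  shows "par x z"
proof (rule ccontr)
  assume xz: "\<not> par x z"
  then obtain B where B: "B \<in> L" "x \<in> B" "z \<in> B"
    using join by blast
  have nx: "y \<noteq> x" "y \<noteq> z" using xz assms by auto
  then have "\<not> collinear L y x" "\<not> collinear L y z"
    using assms par_sym[OF assms(1)] by (auto simp: par_def parallel_def)
  moreover from this B have "y \<notin> B" by (auto simp: collinear_def)
  ultimately have "x = z"
    using unique_noncollinear[OF assms(3) B(1)] B by blast
  then show False using xz by simp
qed

text \<open>A plane is represented by its set of lines; its points are \<open>\<Union>E\<close>.\<close>

definition plane :: "'p set set \<Rightarrow> bool" where
  "plane E \<longleftrightarrow> E \<subseteq> L \<and> (\<exists>X\<in>E. \<exists>Y\<in>E. X \<noteq> Y) \<and> (\<forall>X\<in>E. \<forall>Y\<in>E. \<exists>z. z \<in> X \<and> z \<in> Y) \<and>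
     (\<forall>M\<in>L. \<forall>x\<in>M. \<forall>y\<in>M. x \<noteq> y \<and> x \<in> \<Union>E \<and> y \<in> \<Union>E \<longrightarrow> M \<in> E)"

lemma plane_line: "\<lbrakk>plane E; X \<in> E\<rbrakk> \<Longrightarrow> X \<in> L"
  by (auto simp: plane_def)

lemma plane_meet: "\<lbrakk>plane E; X \<in> E; Y \<in> E\<rbrakk> \<Longrightarrow> \<exists>z. z \<in> X \<and> z \<in> Y"
  by (auto simp: plane_def)

lemma plane_join: "\<lbrakk>plane E; M \<in> L; x \<in> M; y \<in> M; x \<noteq> y; x \<in> \<Union>E; y \<in> \<Union>E\<rbrakk> \<Longrightarrow> M \<in> E"
  unfolding plane_def by blast

end

section \<open>Choice of points, and triangles crossed by a line\<close>

locale vy_net = dual_net +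
  assumes vy: "VY L"
    and three: "\<exists>x\<in>P. \<exists>y\<in>P. \<exists>z\<in>P. \<not> par x y \<and> \<not> par x z \<and> \<not> par y z"
begin

text \<open>Among three vertical lines one avoids both \<open>u\<close> and \<open>v\<close>, and
  \<open>M\<close> has a point on it. The case \<open>u = v\<close> is allowed.\<close>

lemma third_point:
  assumes "M \<in> L" "u \<in> P" "v \<in> P"
  shows "\<exists>w\<in>M. \<not> par w u \<and> \<not> par w v"
proof -
  obtain x y z where xyz: "x \<in> P" "y \<in> P" "z \<in> P" "\<not> par x y" "\<not> par x z" "\<not> par y z"
    using three by blast
  have "\<exists>t\<in>P. \<not> par t u \<and> \<not> par t v"
    using xyz assms par_sym par_trans by meson
  then obtain t where t: "t \<in> P" "\<not> par t u" "\<not> par t v" by blast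
  obtain w where w: "w \<in> M" "par t w" using par_point[OF assms(1) t(1)] by blast
  then have "\<not> par w u" "\<not> par w v"
    using t par_trans in_P assms(1) by blast+
  then show ?thesis using w by blast
qed

text \<open>(VY) in a form that needs no explicit triangle: \<open>z\<close> off \<open>Z\<close> is
  what makes the three intersection points distinct.\<close>

lemma pasch:
  assumes "X \<in> L" "Y \<in> L" "Z \<in> L" "M \<in> L" "X \<noteq> Y" "z \<in> X" "z \<in> Y" "z \<notin> Z"
    and "\<exists>y. y \<in> X \<and> y \<in> Z" "\<exists>x. x \<in> Y \<and> x \<in> Z"
    and "s \<in> M" "s \<in> X" "t \<in> M" "t \<in> Y" "s \<noteq> t"
  shows "\<exists>w. w \<in> M \<and> w \<in> Z"
proof -
  obtain x y where xy: "x \<in> Y" "x \<in> Z" "y \<in> X" "y \<in> Z" using assms by blast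
  have n: "x \<noteq> z" "y \<noteq> z" using xy assms by auto
  then have "x \<noteq> y" using meet_eqI[of X Y] xy assms by metis
  have d: "X \<noteq> Z" "Y \<noteq> Z" using assms by auto
  have e: "w = z" if "w \<in> X" "w \<in> Y" for w using that meet_eqI assms by blast
  have f: "w = x" if "w \<in> Y" "w \<in> Z" for w using that meet_eqI[of Y Z] assms d xy by blast
  have g: "w = y" if "w \<in> X" "w \<in> Z" for w using that meet_eqI[of X Z] assms d xy by blast
  have "vertices {X, Y, Z} = {x, y, z}"
    unfolding vertices_def using assms d e f g xy by blast
  then have "triangle L {X, Y, Z}"
    unfolding triangle_def using assms d xy n \<open>x \<noteq> y\<close> by auto
  then show ?thesis
    using vy assms unfolding VY_def by blast
qed

text \<open>The line \<open>T'\<close> crosses the triangle \<open>X\<close>, \<open>T\<close>,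
  \<open>M\<close> at \<open>x'\<close> on \<open>X\<close> and at a point of \<open>T\<close>. If
  \<open>x = x'\<close>, these two points could coincide.\<close>

lemma transversal_meets_ray_aux:
  assumes "X \<in> L" "T \<in> L" "T' \<in> L" "M \<in> L"
    and "m \<in> X" "m \<in> M" "m \<notin> T"
    and "x \<in> X" "x \<in> T" "x' \<in> X" "x' \<in> T'" "x \<noteq> x'"
    and "\<exists>w. w \<in> T \<and> w \<in> T'" "\<exists>z. z \<in> T \<and> z \<in> M"
  shows "\<exists>w. w \<in> T' \<and> w \<in> M"
proof (cases "M = X")
  case False
  obtain w where w: "w \<in> T" "w \<in> T'" using assms by blast
  have "X \<noteq> T" using assms by blast
  then have "w \<noteq> x'" using w assms meet_eqI[of X T x x'] by blast
  have "x \<notin> M" using False assms meet_eqI[of X M x m] by blast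
  then show ?thesis
    using pasch[of X T M T' x x' w] \<open>X \<noteq> T\<close> \<open>w \<noteq> x'\<close> w assms by blast
qed (use assms in blast)

text \<open>By \<open>pasch\<close> on \<open>X\<close>, \<open>Y\<close>, \<open>T\<close> the two
  transversals meet. If they are distinct, they cut \<open>X\<close> or \<open>Y\<close> in
  different points, and the auxiliary lemma works on that line. Thus a line through \<open>m\<close>
  that meets one transversal meets all of them.\<close>

lemma transversal_meets_ray:
  assumes "X \<in> L" "Y \<in> L" "T \<in> L" "T' \<in> L" "M \<in> L" "X \<noteq> Y"
    and "m \<in> X" "m \<in> Y" "m \<in> M" "m \<notin> T" "m \<notin> T'"
    and "\<exists>x. x \<in> X \<and> x \<in> T" "\<exists>x. x \<in> X \<and> x \<in> T'"
    and "\<exists>y. y \<in> Y \<and> y \<in> T" "\<exists>y. y \<in> Y \<and> y \<in> T'"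
    and z: "\<exists>z. z \<in> T \<and> z \<in> M"
  shows "\<exists>w. w \<in> T' \<and> w \<in> M"
proof -
  obtain x x' y y' where xy: "x \<in> X" "x \<in> T" "x' \<in> X" "x' \<in> T'" "y \<in> Y" "y \<in> T" "y' \<in> Y" "y' \<in> T'"
    using assms by blast
  have "x' \<noteq> y'" using xy assms meet_eqI[of X Y m x'] by blast
  have tt: "\<exists>w. w \<in> T \<and> w \<in> T'"
    using pasch[of X Y T T' m x' y'] xy assms \<open>x' \<noteq> y'\<close> by blast
  consider "x \<noteq> x'" | "y \<noteq> y'" | "T = T'"
    using line_eqI[of T T' x' y'] assms xy \<open>x' \<noteq> y'\<close> by blast
  then show ?thesis
  proof cases
    case 1
    then show ?thesis using transversal_meets_ray_aux[of X T T' M m x x'] tt xy assms by blast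
  next
    case 2
    then show ?thesis using transversal_meets_ray_aux[of Y T T' M m y y'] tt xy assms by blast
  qed (use z in blast)
qed

section \<open>Planes spanned by two intersecting lines\<close>

text \<open>The plane spanned by \<open>X\<close> and \<open>Y\<close> consists of the transversals of \<open>X\<close> and \<open>Y\<close> together with
  the lines through \<open>m\<close> that meet some transversal.\<close>

lemma plane_exists:
  assumes X: "X \<in> L" and Y: "Y \<in> L" and XY: "X \<noteq> Y" and m: "m \<in> X" "m \<in> Y"
  shows "\<exists>E. plane E \<and> X \<in> E \<and> Y \<in> E"
proof -
  define T where "T = {M \<in> L. m \<notin> M \<and> (\<exists>x. x \<in> X \<and> x \<in> M) \<and> (\<exists>y. y \<in> Y \<and> y \<in> M)}"
  define R where "R = {M \<in> L. m \<in> M \<and> (\<exists>N\<in>T. \<exists>z. z \<in> N \<and> z \<in> M)}"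
  have mP: "m \<in> P" using in_P X m by blast
  obtain x where x: "x \<in> X" "\<not> par x m" using third_point[OF X mP mP] by blast
  obtain y where y: "y \<in> Y" "\<not> par y x" "\<not> par y m"
    using third_point[OF Y in_P[OF X x(1)] mP] by blast
  obtain N where N: "N \<in> L" "x \<in> N" "y \<in> N" using join y(2) by blast
  have "x \<noteq> m" "y \<noteq> m" using x y by auto
  have "m \<notin> N"
    using line_eqI[of X N m x] line_eqI[of Y N m y] N X Y XY m x y \<open>x \<noteq> m\<close> \<open>y \<noteq> m\<close> by blast
  then have NT: "N \<in> T" using N x y by (auto simp: T_def)
  have XR: "X \<in> R" and YR: "Y \<in> R" using NT N x y X Y m unfolding R_def by blast+
  have TL: "\<And>M. M \<in> T \<Longrightarrow> M \<in> L \<and> m \<notin> M" and RL: "\<And>M. M \<in> R \<Longrightarrow> M \<in> L \<and> m \<in> M"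
    by (auto simp: T_def R_def)
  have TT: "\<exists>z. z \<in> A \<and> z \<in> B" if A: "A \<in> T" and B: "B \<in> T" for A B
  proof -
    obtain s t where st: "s \<in> A" "s \<in> X" "t \<in> A" "t \<in> Y" using A by (auto simp: T_def)
    then have "s \<noteq> t" using meet_eqI[OF X Y XY, of m s] m TL[OF A] by blast
    then show ?thesis
      using pasch[of X Y B A m s t] st X Y XY m A B unfolding T_def by blast
  qed
  have TR: "\<exists>z. z \<in> A \<and> z \<in> B" if A: "A \<in> T" and B: "B \<in> R" for A B
  proof -
    obtain K where K: "K \<in> T" "\<exists>z. z \<in> K \<and> z \<in> B" using B by (auto simp: R_def)
    show ?thesis
      by (rule transversal_meets_ray[of X Y K A B m]) (use K A B X Y XY m in \<open>auto simp: T_def R_def\<close>)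
  qed
  have meet: "\<exists>z. z \<in> A \<and> z \<in> B" if "A \<in> T \<union> R" "B \<in> T \<union> R" for A B
    using that TT TR RL by blast
  have ray: "\<exists>U\<in>R. w \<in> U" if w: "w \<in> \<Union>(T \<union> R)" "\<not> par w m" for w
  proof -
    obtain A where A: "A \<in> T \<union> R" "w \<in> A" using w by blast
    obtain U where U: "U \<in> L" "w \<in> U" "m \<in> U" using join[OF w(2)] by blast
    have "w \<noteq> m" using w by auto
    show ?thesis
    proof (cases "A \<in> T")
      case True
      then show ?thesis using U A unfolding R_def by blast
    qed (use A in blast)
  qed
  \<comment> \<open>If \<open>U\<close> is a transversal, (VY) applies to \<open>U\<close>,
    \<open>V\<close>, \<open>Q\<close>. If \<open>U\<close> and \<open>V\<close> both pass through
    \<open>m\<close>, they form no triangle with \<open>Q\<close>; then the fixed transversal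
    \<open>N\<close> replaces one of them, and \<open>M\<close> meets \<open>N\<close> by (VY) on
    \<open>U\<close>, \<open>V\<close>, \<open>N\<close>.\<close>
  have cross: "\<exists>q. q \<in> Q \<and> q \<in> M"
    if Q: "Q = X \<or> Q = Y" and M: "M \<in> L" "m \<notin> M" and u: "u \<in> M" "u \<in> U" "U \<in> T \<union> R"
      and v: "v \<in> M" "v \<in> V" "V \<in> R" and uv: "u \<noteq> v" for Q M u v U V
  proof (cases "U = Q \<or> V = Q")
    case False
    have QR: "Q \<in> R" using Q XR YR by blast
    have QL: "Q \<in> L" "m \<in> Q" using RL QR by auto
    have VL: "V \<in> L" "m \<in> V" using RL v by auto
    show ?thesis
    proof (cases "U \<in> T")
      case True
      obtain k where k: "k \<in> U" "k \<in> V" using TR True v by blast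
      have UL: "U \<in> L" "m \<notin> U" using TL True by auto
      have "k \<notin> Q" using line_eqI[of V Q k m] False k UL VL QL by blast
      then show ?thesis
        using pasch[of U V Q M k u v] UL VL QL M k u v uv TR[OF True QR] by blast
    next
      case False
      then have UR: "U \<in> R" using u by blast
      have UL: "U \<in> L" "m \<in> U" using RL UR by auto
      have UV: "U \<noteq> V" using line_eqI[of U M u v] UL M u v uv by blast
      obtain w where w: "w \<in> M" "w \<in> N"
        using pasch[of U V N M m u v] UL VL M u v uv UV TL[OF NT] TR[OF NT UR] TR[OF NT v(3)] by blast
      have *: "\<exists>q. q \<in> Q \<and> q \<in> M" if W: "W \<in> R" "W \<noteq> Q" "s \<in> M" "s \<in> W" "s \<noteq> w" for W s
      proof -
        have WL: "W \<in> L" "m \<in> W" using RL W by auto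
        obtain k where k: "k \<in> N" "k \<in> W" using TR NT W by blast
        have "k \<notin> Q" using line_eqI[of W Q k m] W k WL QL TL[OF NT] by blast
        then show ?thesis
          using pasch[of W N Q M k s w] W k WL QL TL[OF NT] M w TR[OF NT QR] by blast
      qed
      show ?thesis
        using *[of U u] *[of V v] UR u v uv \<open>\<not> (U = Q \<or> V = Q)\<close> by blast
    qed
  qed (use u v in blast)
  have closed: "M \<in> T \<union> R"
    if M: "M \<in> L" "u \<in> M" "v \<in> M" "u \<noteq> v" "u \<in> \<Union>(T \<union> R)" "v \<in> \<Union>(T \<union> R)" for M u v
  proof (cases "m \<in> M")
    case True
    obtain s where s: "s \<in> M" "s \<noteq> m" "s \<in> \<Union>(T \<union> R)" using M by metis
    then have "\<not> par s m" using par_on_line[of M s m] M True by blast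
    then obtain U where U: "U \<in> R" "s \<in> U" using ray s by blast
    then have "U = M" using line_eqI[of U M s m] RL[of U] s M True by blast
    then show ?thesis using U by blast
  next
    case False
    \<comment> \<open>\<open>cross\<close> wants one of the two points on a line of
      \<open>R\<close>, which \<open>ray\<close> gives for a point not parallel to \<open>m\<close>.
      One of \<open>u\<close>, \<open>v\<close> is such a point, as otherwise \<open>M\<close> would
      contain two parallel points.\<close>
    have *: "M \<in> T" if h: "s \<in> M" "t \<in> M" "s \<noteq> t" "s \<in> \<Union>(T \<union> R)" "t \<in> \<Union>(T \<union> R)" "\<not> par t m" for s t
    proof -
      obtain U where "s \<in> U" "U \<in> T \<union> R" using h by blast
      moreover obtain V where "t \<in> V" "V \<in> R" using ray h by blast
      ultimately show ?thesis
        using cross[of X M s U t V] cross[of Y M s U t V] h M False unfolding T_def by blast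
    qed
    have "\<not> (par u m \<and> par v m)"
      using par_on_line[of M u v] par_trans[of u m v] par_sym mP M by blast
    then show ?thesis using *[of u v] *[of v u] M by blast
  qed
  have "plane (T \<union> R)"
    unfolding plane_def using TL RL XR YR XY meet closed by (intro conjI) blast+
  then show ?thesis using XR YR by blast
qed

text \<open>A line of \<open>E\<close> off \<open>m\<close> meets \<open>X\<close> and
  \<open>Y\<close> in two points of \<open>F\<close>. A line through \<open>m\<close> other than
  \<open>X\<close> is caught by joining one of its points to a point of \<open>X\<close> by a line
  \<open>K\<close> off \<open>m\<close>.\<close>

lemma plane_subset:
  assumes E: "plane E" "X \<in> E" "Y \<in> E" and F: "plane F" "X \<in> F" "Y \<in> F" and XY: "X \<noteq> Y"
  shows "E \<subseteq> F"
proof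
  fix M assume M: "M \<in> E"
  have L: "X \<in> L" "Y \<in> L" "M \<in> L" using plane_line E M by blast+
  obtain m where m: "m \<in> X" "m \<in> Y" using plane_meet E by blast
  have trans: "K \<in> F" if K: "K \<in> E" "m \<notin> K" for K
  proof -
    obtain s t where st: "s \<in> K" "s \<in> X" "t \<in> K" "t \<in> Y" using plane_meet E K by meson
    then have "s \<noteq> t" using meet_eqI[OF L(1,2) XY m, of s] K by blast
    then show ?thesis using plane_join[OF F(1), of K s t] st K F plane_line[OF E(1)] by blast
  qed
  show "M \<in> F"
  proof (cases "m \<in> M \<and> M \<noteq> X")
    case True
    have mP: "m \<in> P" using in_P L m by blast
    obtain z where z: "z \<in> M" "\<not> par z m" using third_point[OF L(3) mP mP] by blast
    obtain x where x: "x \<in> X" "\<not> par x z" "\<not> par x m" using third_point[OF L(1) in_P[OF L(3) z(1)] mP] by blast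
    obtain K where K: "K \<in> L" "x \<in> K" "z \<in> K" using join x by blast
    have ne: "x \<noteq> z" "x \<noteq> m" "z \<noteq> m" using x z by auto
    have KE: "K \<in> E" using plane_join[OF E(1), of K x z] K x z M E ne by blast
    have "m \<notin> K"
      using line_eqI[of K X x m] line_eqI[of K M z m] K L x z m True ne by blast
    then have "K \<in> F" using trans KE by blast
    then show ?thesis using plane_join[OF F(1) L(3), of z m] F K m z ne True by blast
  qed (use trans M F in blast)
qed

lemma plane_eq:
  assumes "plane E" "X \<in> E" "Y \<in> E" "plane F" "X \<in> F" "Y \<in> F" "X \<noteq> Y"
  shows "E = F"
  using plane_subset assms by blast

text \<open>Since \<open>u\<close> and \<open>v\<close> are parallel, the joins of \<open>w\<close>
  to them are two distinct lines, and both planes contain them.\<close>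

lemma plane_eq_points:
  assumes E: "plane E" "u \<in> \<Union>E" "v \<in> \<Union>E" "w \<in> \<Union>E"
    and F: "plane F" "u \<in> \<Union>F" "v \<in> \<Union>F" "w \<in> \<Union>F"
    and uv: "u \<noteq> v" "par u v" and w: "\<not> par w u"
  shows "E = F"
proof -
  have P: "u \<in> P" "v \<in> P" "w \<in> P" using E in_P plane_line by blast+
  have w': "\<not> par w v" using w par_trans[OF _ par_sym[OF uv(2)] P(2)] by blast
  obtain A where A: "A \<in> L" "w \<in> A" "u \<in> A" using join w by blast
  obtain B where B: "B \<in> L" "w \<in> B" "v \<in> B" using join w' by blast
  have "A \<noteq> B" using par_on_line[of A u v] A B uv by blast
  have ne: "w \<noteq> u" "w \<noteq> v" using w w' by auto
  have "A \<in> E" "B \<in> E" using plane_join[OF E(1)] A B E ne by blast+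
  moreover have "A \<in> F" "B \<in> F" using plane_join[OF F(1)] A B F ne by blast+
  ultimately show ?thesis using plane_eq E(1) F(1) \<open>A \<noteq> B\<close> by blast
qed

section \<open>Vertical traces of planes\<close>

text \<open>So a vertical trace of a plane is determined by any two of its points, like a line of the linear
  space obtained by adjoining the missing subspace. Spatial argument: points \<open>c\<close> of \<open>E\<close> and \<open>d\<close> of \<open>F\<close>
  outside \<open>E\<close> are chosen, and a line \<open>C\<close> of \<open>E\<close> through \<open>r\<close> is projected from the point \<open>n\<close> of \<open>cd\<close> parallel
  to \<open>p\<close> to a line \<open>J\<close> of \<open>F\<close> through \<open>r\<close>. Taking \<open>b\<close> parallel to \<open>d\<close> is what guarantees that the line \<open>kd\<close>
  exists.\<close>

lemma plane_trace:
  assumes E: "plane E" "p \<in> \<Union>E" "q \<in> \<Union>E" "r \<in> \<Union>E"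
    and F: "plane F" "p \<in> \<Union>F" "q \<in> \<Union>F"
    and pq: "p \<noteq> q" "par p q" and pr: "par p r"
  shows "r \<in> \<Union>F"
proof (cases "E = F \<or> r = p \<or> r = q")
  case True
  then show ?thesis using E F by blast
next
  case False
  then have EF: "E \<noteq> F" and rp: "r \<noteq> p" and rq: "r \<noteq> q" by auto
  have EL: "\<And>M. M \<in> E \<Longrightarrow> M \<in> L" and FL: "\<And>M. M \<in> F \<Longrightarrow> M \<in> L"
    using plane_line E(1) F(1) by blast+
  have P: "p \<in> P" "q \<in> P" "r \<in> P" using E in_P EL by blast+
    have par3: "par x p \<longleftrightarrow> par x q" "par x p \<longleftrightarrow> par x r" for x
    using par_trans par_sym pq pr P by blast+
  obtain A where A: "A \<in> E" "p \<in> A" using E by blast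
  obtain c where c: "c \<in> A" "\<not> par c p" using third_point[OF EL[OF A(1)] P(1) P(1)] by blast
  have cP: "c \<in> P" using in_P EL A c by blast
  obtain D where D: "D \<in> F" "p \<in> D" using F by blast
  obtain d where d: "d \<in> D" "\<not> par d p" "\<not> par d c" using third_point[OF FL[OF D(1)] P(1) cP] by blast
  have dE: "d \<notin> \<Union>E" using plane_eq_points[of E p q d F] E F d D pq EF by blast
  have dP: "d \<in> P" using in_P FL D d by blast
  obtain B where B: "B \<in> L" "q \<in> B" "c \<in> B" using join c par3 par_sym by meson
  obtain G where G: "G \<in> L" "q \<in> G" "d \<in> G" using join d par3 par_sym by meson
  obtain N where N: "N \<in> L" "c \<in> N" "d \<in> N" using join d par_sym by meson
  have ne: "c \<noteq> p" "c \<noteq> q" "d \<noteq> p" "d \<noteq> q" "d \<noteq> c" using c d par3 pq by auto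
  have BE: "B \<in> E" using plane_join[OF E(1) B] ne E A c by blast
  have GF: "G \<in> F" using plane_join[OF F(1) G] ne F D d by blast
  have NE: "N \<notin> E" using N dE by blast
  obtain n where n: "n \<in> N" "par p n" using par_point[OF N(1) P(1)] by blast
  have nP: "n \<in> P" using in_P N n by blast
  have parn: "par x p \<longleftrightarrow> par x n" for x using par_trans par_sym n nP P by blast
  have nE: "n \<notin> \<Union>E" using plane_join[OF E(1) N(1), of n c] n N NE A c parn[of c] par_refl[of n] by blast
  obtain b where b: "b \<in> A" "par d b" using par_point[OF EL[OF A(1)] dP] by blast
  have bP: "b \<in> P" using in_P EL A b by blast
  have b': "\<not> par b p" "b \<noteq> c" using par_trans[of d b p] bP b(2) d by blast+
  obtain C where C: "C \<in> L" "r \<in> C" "b \<in> C" using join[of b r] b' par3(2)[of b] by blast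
  have "b \<noteq> r" using b' par3(2)[of b] by auto
  then have CE: "C \<in> E" using plane_join[OF E(1) C] E A b by blast
  obtain a where a: "a \<in> B" "a \<in> C" using plane_meet[OF E(1) BE CE] by blast
  have "par r q" using par3(1)[of r] par3(2)[of r] by simp
  have "par r p" using par3(2)[of r] by simp
  have "C \<noteq> B" using par_on_line[OF B(1), of r q] B C rq \<open>par r q\<close> by auto
  have "a \<noteq> q" using par_on_line[OF C(1), of r q] a C rq \<open>par r q\<close> by auto
  have "A \<noteq> C" using par_on_line[OF C(1), of r p] C A rp \<open>par r p\<close> by auto
  then have "a \<noteq> c" using line_eqI[of A C b c] a C A b b' c EL by blast
  have "\<not> par a p" using par_on_line[OF B(1), of a q] a B \<open>a \<noteq> q\<close> par3(1)[of a] by blast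
  then have an: "\<not> par a n" using parn[of a] by blast
  \<comment> \<open>\<open>H\<close> and \<open>K\<close> project \<open>a\<close> and
    \<open>b\<close> from \<open>n\<close>. The plane of \<open>C\<close> and \<open>H\<close> will
    contain \<open>K\<close> and the image \<open>J\<close> of \<open>C\<close>.\<close>
  obtain H where H: "H \<in> L" "n \<in> H" "a \<in> H" using join[of a n] an by blast
  have "\<not> par b n" using b' parn[of b] by blast
  then obtain K where K: "K \<in> L" "n \<in> K" "b \<in> K" using join[of b n] by blast
  have nen: "n \<noteq> a" "n \<noteq> b" using nE BE a A b by blast+
  have "B \<noteq> N" "B \<noteq> G" "A \<noteq> N" "A \<noteq> D" using BE NE G D d dE A by auto
  \<comment> \<open>This plane contains \<open>G\<close> and \<open>H\<close>, so the image
    \<open>g\<close> of \<open>a\<close> lies on \<open>G\<close>, a line of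
    \<open>F\<close>.\<close>
  obtain PB where PB: "plane PB" "B \<in> PB" "N \<in> PB"
    using plane_exists[of B N c] B N \<open>B \<noteq> N\<close> by blast
  have "G \<in> PB" using plane_join[OF PB(1) G(1), of q d] G B N PB ne by blast
  moreover have "H \<in> PB" using plane_join[OF PB(1) H(1), of n a] H n a B PB nen by blast
  ultimately obtain g where g: "g \<in> G" "g \<in> H" using plane_meet PB by meson
  have "C \<noteq> H" using nE H CE by blast
  obtain PC where PC: "plane PC" "C \<in> PC" "H \<in> PC"
    using plane_exists[of C H a] C H \<open>C \<noteq> H\<close> a by blast
  have KPC: "K \<in> PC" using plane_join[OF PC(1) K(1), of n b] K H C PC nen by blast
  have "B \<noteq> H" using nE H BE by blast
  have "g \<noteq> q" using line_eqI[of B H q a] B H a g \<open>a \<noteq> q\<close> \<open>B \<noteq> H\<close> by blast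
  then have gr: "\<not> par g r" using par_on_line[OF G(1), of g q] g G par3[of g] by blast
  then obtain J where J: "J \<in> L" "g \<in> J" "r \<in> J" using join by blast
  have "g \<noteq> r" using gr by auto
  have JPC: "J \<in> PC" using plane_join[OF PC(1) J] J g C PC \<open>g \<noteq> r\<close> by blast
  obtain k where k: "k \<in> J" "k \<in> K" using plane_meet PC JPC KPC by meson
  have "C \<noteq> K" using nE K CE by blast
  have "r \<noteq> n" using nE E by blast
  have "J \<noteq> K" using par_on_line[OF K(1), of r n] J K \<open>r \<noteq> n\<close> parn[of r] \<open>par r p\<close> by blast
  have "B \<inter> G \<subseteq> {q}" using meet_eqI[of B G q] B G \<open>B \<noteq> G\<close> by blast
  then have "a \<notin> G" using a \<open>a \<noteq> q\<close> by blast
  have "\<not> par k d"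
  proof
    assume "par k d"
    then have "par k b" using par_trans[of k d b] b(2) dP by blast
    then have "k = b" using par_on_line[OF K(1)] k K by blast
    then have "J = C" using line_eqI[of J C r b] J C k \<open>b \<noteq> r\<close> by blast
    then have "g = a" using meet_eqI[of C H a g] C H a g J \<open>C \<noteq> H\<close> by blast
    then show False using g \<open>a \<notin> G\<close> by blast
  qed
  then obtain Q where Q: "Q \<in> L" "k \<in> Q" "d \<in> Q" using join by blast
  have "k \<noteq> d" using \<open>\<not> par k d\<close> by auto
  \<comment> \<open>This plane contains \<open>K\<close> and \<open>Q\<close>, so \<open>Q\<close>
    meets \<open>A\<close>. The aim is \<open>s = p\<close>: then \<open>Q\<close> is
    \<open>D\<close>, and \<open>k\<close> is a second point of \<open>J\<close> in
    \<open>F\<close>.\<close>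
  obtain PA where PA: "plane PA" "A \<in> PA" "N \<in> PA"
    using plane_exists[of A N c] A EL N c \<open>A \<noteq> N\<close> by blast
  have "K \<in> PA" using plane_join[OF PA(1) K(1), of n b] K n b A PA nen by blast
  then have "Q \<in> PA" using plane_join[OF PA(1) Q] k N PA \<open>k \<noteq> d\<close> by blast
  then obtain s where s: "s \<in> Q" "s \<in> A" using plane_meet PA by meson
  have "Q \<noteq> G"
  proof
    assume "Q = G"
    have "G \<notin> E" using dE G by blast
    then have "s = q" using plane_join[OF E(1) G(1), of s q] s \<open>Q = G\<close> G A E by blast
    then show False using par_on_line[of A p q] A EL s pq by blast
  qed
  obtain R where R: "plane R" "Q \<in> R" "G \<in> R"
    using plane_exists[of Q G d] Q G \<open>Q \<noteq> G\<close> by blast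
  have "A \<noteq> B" using par_on_line[OF B(1), of p q] A B pq by blast
  then have "a \<noteq> b" using meet_eqI[of A B c a] A B a b c EL \<open>a \<noteq> c\<close> by blast
  then have "H \<noteq> K" using line_eqI[of H C a b] H K C a \<open>C \<noteq> H\<close> by blast
  have "g \<noteq> k"
  proof
    assume "g = k"
    then have "g = n" using meet_eqI[of H K g n] H K g k \<open>H \<noteq> K\<close> by blast
    then have "n = q" using par_on_line[OF G(1), of q n] g G parn[of q] par_sym[OF pq(2)] by blast
    then show False using nE E by blast
  qed
  have "J \<in> R" using plane_join[OF R(1) J(1), of g k] J k g Q R \<open>g \<noteq> k\<close> by blast
  \<comment> \<open>Otherwise \<open>q\<close>, \<open>r\<close>, \<open>s\<close> lie both in
    \<open>E\<close> and in the plane of \<open>Q\<close> and \<open>G\<close>, which contains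
    \<open>J\<close>. The two planes would be equal, although \<open>d\<close> is off
    \<open>E\<close>.\<close>
  have "s = p"
  proof (rule ccontr)
    assume "s \<noteq> p"
    then have "\<not> par s p" using par_on_line[of A s p] EL A s by blast
    then have "\<not> par s q" using par3(1)[of s] by blast
    moreover have "par q r" using \<open>par r q\<close> par_sym by blast
    ultimately have "E = R"
      using plane_eq_points[of E q r s R] E R A s Q G J \<open>J \<in> R\<close> rq by blast
    then show False using dE G R by blast
  qed
  then have "Q = D" using line_eqI[of Q D p d] Q D d s FL ne by blast
  then have "J \<in> F" using plane_join[OF F(1) J(1), of g k] J k g Q D GF \<open>g \<noteq> k\<close> by blast
  then show ?thesis using J by blast
qed

section \<open>Desargues configurations\<close>

text \<open>If the line \<open>D = rb'\<close> missed \<open>a'\<close>, the plane of \<open>C\<close> and \<open>D\<close> would share with the plane of \<open>A\<close> and \<open>A'\<close>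
  both \<open>b, b'\<close> and a point of the vertical line of \<open>c\<close>, so the two planes would coincide.\<close>

lemma desargues_nonplanar:
  assumes E: "plane E" "A \<in> E" "B \<in> E" "C \<in> E" and AC: "A \<noteq> C"
    and abc: "a \<in> B" "a \<in> C" "b \<in> A" "b \<in> C" "c \<in> A" "c \<in> B" "a \<noteq> b" "b \<noteq> c"
    and L': "A' \<in> L" "B' \<in> L" "C' \<in> L"
    and abc': "a' \<in> B'" "a' \<in> C'" "b' \<in> A'" "b' \<in> C'" "c' \<in> A'" "c' \<in> B'"
    and persp: "par a a'" "par b b'" "par c c'"
    and pq: "p \<in> A" "p \<in> A'" "q \<in> B" "q \<in> B'" "p \<noteq> q" "par p q"
    and ab: "\<not> par p a" "\<not> par p b"
    and r: "r \<in> C" "par p r" and c': "c' \<notin> \<Union>E"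
  shows "r \<in> C'"
proof -
  have EL: "\<And>M. M \<in> E \<Longrightarrow> M \<in> L" using plane_line E(1) by blast
  have P: "p \<in> P" "q \<in> P" "r \<in> P" "a \<in> P" "b \<in> P" "c \<in> P" "a' \<in> P" "b' \<in> P"
    using in_P EL E L' abc abc' pq r by blast+
  have "A \<noteq> A'" "B \<noteq> B'" "c \<noteq> c'" using c' E abc abc' by blast+
  have "A' \<noteq> B'" using par_on_line[OF L'(1), of p q] pq by blast
  have "b \<noteq> p" "a \<noteq> p" using ab by auto
  have "b \<noteq> b'" using line_eqI[of A A' b p] EL E L' abc abc' pq \<open>b \<noteq> p\<close> \<open>A \<noteq> A'\<close> by blast
  obtain F where F: "plane F" "A' \<in> F" "B' \<in> F"
    using plane_exists[of A' B' c'] L' abc' \<open>A' \<noteq> B'\<close> by blast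
  have rF: "r \<in> \<Union>F" using plane_trace[of E p q r F] E F pq r by blast
  have "\<not> par r b'"
    using par_trans[of p r b'] par_trans[of p b' b] par_sym[OF persp(2)] r P ab by blast
  then obtain D where D: "D \<in> L" "r \<in> D" "b' \<in> D" using join by blast
  have "r \<noteq> b'" using \<open>\<not> par r b'\<close> by auto
  have DF: "D \<in> F" using plane_join[OF F(1) D] rF abc' F \<open>r \<noteq> b'\<close> by blast
  obtain y where y: "y \<in> B'" "y \<in> D" using plane_meet[OF F(1)] F DF by blast
  have "a' \<noteq> b'"
    using par_trans[of a a' b] par_sym[OF persp(2)] persp(1) P abc par_on_line[of C a b] EL E by blast
  show ?thesis
  proof (cases "y = a'")
    case True
    then show ?thesis using line_eqI[of C' D a' b'] L' D y abc' \<open>a' \<noteq> b'\<close> by blast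
  next
    case False
    have "C \<noteq> D" using par_on_line[of C b b'] EL E D abc persp \<open>b \<noteq> b'\<close> by blast
    obtain S where S: "plane S" "C \<in> S" "D \<in> S"
      using plane_exists[of C D r] EL E D r \<open>C \<noteq> D\<close> by blast
    obtain PB where PB: "plane PB" "B \<in> PB" "B' \<in> PB"
      using plane_exists[of B B' q] EL E L' pq \<open>B \<noteq> B'\<close> by blast
    obtain PA where PA: "plane PA" "A \<in> PA" "A' \<in> PA"
      using plane_exists[of A A' p] EL E L' pq \<open>A \<noteq> A'\<close> by blast
    have "\<not> par y a"
      using par_trans[of y a a'] par_on_line[of B' y a'] L' y abc' persp P False by blast
    then obtain Y where Y: "Y \<in> L" "y \<in> Y" "a \<in> Y" using join by blast
    have "y \<noteq> a" using \<open>\<not> par y a\<close> by auto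
    have YS: "Y \<in> S" using plane_join[OF S(1) Y] y abc S \<open>y \<noteq> a\<close> by blast
    have YPB: "Y \<in> PB" using plane_join[OF PB(1) Y] y abc PB \<open>y \<noteq> a\<close> by blast
    \<comment> \<open>The plane of \<open>B\<close> and \<open>B'\<close> contains \<open>z\<close>,
      \<open>c\<close> and \<open>c'\<close>; its trace through \<open>c\<close> and
      \<open>c'\<close> is shared with the plane of \<open>A\<close> and \<open>A'\<close>, which
      therefore contains \<open>z\<close>.\<close>
    obtain z where z: "z \<in> Y" "par c z" using par_point[OF Y(1) P(6)] by blast
    have zP: "z \<in> P" using in_P Y z by blast
    have "z \<in> \<Union>PA"
      using plane_trace[of PB c c' z PA] PB PA YPB z abc abc' persp \<open>c \<noteq> c'\<close> by blast
    moreover have "\<not> par z b"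
      using par_trans[of c z b] z zP par_on_line[of A c b] EL E abc by blast
    ultimately have "PA = S"
      using plane_eq_points[of PA b b' z S] PA S D YS z abc abc' persp \<open>b \<noteq> b'\<close> by blast
    then have "PA = E" using plane_eq[of PA A C E] PA S E AC by blast
    then show ?thesis using PA abc' c' by blast
  qed
qed

text \<open>One of the disjoint lines is not in \<open>E\<close>, so it has a point \<open>m\<close>
  off \<open>E\<close>. A line from \<open>m\<close> to a point \<open>x\<close> of \<open>E\<close>
  meets the plane only in \<open>x\<close>; with \<open>x\<close> not parallel to \<open>c\<close>,
  its point parallel to \<open>c\<close> is off \<open>E\<close>.\<close>

lemma point_off_plane:
  assumes E: "plane E" and X: "X \<in> L" "Y \<in> L" "X \<inter> Y = {}" and c: "c \<in> P"
  shows "\<exists>d\<in>P. d \<notin> \<Union>E \<and> par c d"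
proof -
  obtain M where M: "M \<in> L" "M \<notin> E" using plane_meet[OF E] X by blast
  obtain u v where "u \<in> M" "v \<in> M" "u \<noteq> v" using two_points[OF M(1)] by blast
  then obtain m where m: "m \<in> M" "m \<notin> \<Union>E" using plane_join[OF E M(1), of u v] M by blast
  obtain A where A: "A \<in> E" using E by (auto simp: plane_def)
  obtain x where x: "x \<in> A" "\<not> par x m" "\<not> par x c"
    using third_point[OF plane_line[OF E A] in_P[OF M(1) m(1)] c] by blast
  obtain K where K: "K \<in> L" "x \<in> K" "m \<in> K" using join x by blast
  obtain d where d: "d \<in> K" "par c d" using par_point[OF K(1) c] by blast
  have "x \<noteq> d" using d x par_sym by blast
  then have "d \<notin> \<Union>E" using plane_join[OF E K(1), of x d] K d A x m by blast
  then show ?thesis using d in_P K by blast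
qed

text \<open>Two triangles in one plane are both compared with a third triangle, in perspective with both
  and having its vertex \<open>d\<close> off that plane.\<close>

lemma desargues:
  assumes disj: "X \<in> L" "Y \<in> L" "X \<inter> Y = {}"
    and L: "A \<in> L" "B \<in> L" "C \<in> L" "A \<noteq> B" "A \<noteq> C"
    and abc: "a \<in> B" "a \<in> C" "b \<in> A" "b \<in> C" "c \<in> A" "c \<in> B" "a \<noteq> b" "b \<noteq> c"
    and L': "A' \<in> L" "B' \<in> L" "C' \<in> L" "A' \<noteq> B'" "A' \<noteq> C'"
    and abc': "a' \<in> B'" "a' \<in> C'" "b' \<in> A'" "b' \<in> C'" "c' \<in> A'" "c' \<in> B'" "a' \<noteq> b'" "b' \<noteq> c'"
    and persp: "par a a'" "par b b'" "par c c'"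
    and pq: "p \<in> A" "p \<in> A'" "q \<in> B" "q \<in> B'" "p \<noteq> q" "par p q"
  shows "\<exists>r. r \<in> C \<and> r \<in> C' \<and> par p r"
proof -
  have P: "p \<in> P" "q \<in> P" "a \<in> P" "b \<in> P" "c \<in> P" "c' \<in> P"
    using in_P L L' abc abc' pq by blast+
  have qx: "par q x" if "par p x" for x using par_trans[OF par_sym[OF pq(6)] that P(1)] .
  have pc: "\<not> par p c"
    using par_on_line[of A p c] par_on_line[of B q c] qx[of c] L abc pq by blast
  have pc': "\<not> par p c'"
    using par_on_line[of A' p c'] par_on_line[of B' q c'] qx[of c'] L' abc' pq by blast
  have ne: "p \<noteq> c" "p \<noteq> c'" using pc pc' by auto
  have nq: "q \<noteq> c" "q \<noteq> c'" using pc pc' pq by auto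
  \<comment> \<open>If \<open>c = c'\<close>, the triangles coincide. If \<open>p\<close> is
    parallel to \<open>a\<close> or to \<open>b\<close>, then \<open>a = a' = q\<close> or
    \<open>b = b' = p\<close> is the required point.\<close>
  consider "c = c'" | "c \<noteq> c'" "par p a" | "c \<noteq> c'" "par p b"
    | "c \<noteq> c'" "\<not> par p a" "\<not> par p b" by blast
  then show ?thesis
  proof cases
    case 1
    have "A = A'" using line_eqI[of A A' p c] 1 L L' abc abc' pq ne by blast
    moreover have "B = B'" using line_eqI[of B B' q c] 1 L L' abc abc' pq nq by blast
    ultimately have "a = a'" "b = b'"
      using par_on_line[of B a a'] par_on_line[of A b b'] L abc abc' persp by blast+
    then have "C = C'" using line_eqI[of C C' a b] L L' abc abc' by blast
    then show ?thesis using par_point[OF L(3) P(1)] by blast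
  next
    case 2
    have "q = a" using par_on_line[of B q a] qx 2 L abc pq by blast
    moreover have "q = a'"
      using par_on_line[of B' q a'] \<open>q = a\<close> persp L' abc' pq by blast
    ultimately show ?thesis using abc abc' pq by blast
  next
    case 3
    have "p = b" using par_on_line[of A p b] 3 L abc pq by blast
    moreover have "p = b'"
      using par_on_line[of A' p b'] \<open>p = b\<close> persp L' abc' pq by blast
    ultimately show ?thesis using abc abc' par_refl by blast
  next
    case 4
    obtain E where E: "plane E" "A \<in> E" "B \<in> E"
      using plane_exists[of A B c] L abc by blast
    have CE: "C \<in> E" using plane_join[OF E(1) L(3), of a b] E abc by blast
    obtain r where r: "r \<in> C" "par p r" using par_point[OF L(3) P(1)] by blast
    show ?thesis
    proof (cases "c' \<in> \<Union>E")
      case False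
      have "r \<in> C'"
        by (rule desargues_nonplanar[OF E CE L(5) abc L'(1-3) abc'(1-6) persp pq 4(2,3) r False])
      then show ?thesis using r by blast
    next
      case True
      have AE: "A' \<in> E" using plane_join[OF E(1) L'(1), of p c'] E pq abc' True ne by blast
      have BE: "B' \<in> E" using plane_join[OF E(1) L'(2), of q c'] E pq abc' True nq by blast
      have CE': "C' \<in> E" using plane_join[OF E(1) L'(3), of a' b'] AE BE abc' by blast
      obtain r' where r': "r' \<in> C'" "par p r'" using par_point[OF L'(3) P(1)] by blast
      \<comment> \<open>As \<open>d\<close> is parallel to \<open>c\<close> and \<open>c'\<close>,
        it can replace either. The third triangle has sides through \<open>p\<close> and
        \<open>q\<close>, so the nonplanar case, used twice, puts \<open>r\<close> and
        \<open>r'\<close> on its third side \<open>C2\<close>, where parallel points are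
        equal.\<close>
      obtain d where d: "d \<notin> \<Union>E" "par c d" "d \<in> P" using point_off_plane[OF E(1) disj P(5)] by blast
      have pd: "\<not> par p d"
        using par_trans[of p d c] par_sym[OF d(2)] d(3) pc by blast
      have qd: "\<not> par q d" using par_trans[of p q d] pd pq P by blast
      obtain A2 where A2: "A2 \<in> L" "p \<in> A2" "d \<in> A2" using join[OF pd] by blast
      obtain B2 where B2: "B2 \<in> L" "q \<in> B2" "d \<in> B2" using join[OF qd] by blast
      obtain b2 where b2: "b2 \<in> A2" "par b b2" using par_point[OF A2(1) P(4)] by blast
      obtain a2 where a2: "a2 \<in> B2" "par a a2" using par_point[OF B2(1) P(3)] by blast
      have P2: "a2 \<in> P" "b2 \<in> P" "d \<in> P" "a' \<in> P" "b' \<in> P" "c' \<in> P"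
        using in_P A2 B2 a2 b2 L' abc' by blast+
      have "\<not> par a2 b2"
        using par_trans[of a a2 b] par_trans[of a2 b2 b] a2 par_sym[OF b2(2)] P2
          par_on_line[of C a b] L abc by blast
      then obtain C2 where C2: "C2 \<in> L" "a2 \<in> C2" "b2 \<in> C2" using join by blast
      have "r \<in> C2"
        by (rule desargues_nonplanar[OF E CE L(5) abc A2(1) B2(1) C2(1) a2(1) C2(2) b2(1) C2(3)
              A2(3) B2(3) a2(2) b2(2) d(2) pq(1) A2(2) pq(3) B2(2) pq(5,6) 4(2,3) r d(1)])
      moreover have "r' \<in> C2"
      proof (rule desargues_nonplanar[OF E(1) AE BE CE' L'(5) abc' A2(1) B2(1) C2(1) a2(1) C2(2)
              b2(1) C2(3) A2(3) B2(3) _ _ _ pq(2) A2(2) pq(4) B2(2) pq(5,6) _ _ r' d(1)])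
        show "par a' a2" "par b' b2" "par c' d"
          using par_trans[OF par_sym[OF persp(1)] a2(2) P(3)]
            par_trans[OF par_sym[OF persp(2)] b2(2) P(4)]
            par_trans[OF par_sym[OF persp(3)] d(2) P(5)] by blast+
        show "\<not> par p a'" "\<not> par p b'"
          using par_trans[OF _ par_sym[OF persp(1)] P2(4)] par_trans[OF _ par_sym[OF persp(2)] P2(5)]
            4 by blast+
      qed
      moreover have "par r r'"
        using par_trans[OF par_sym[OF r(2)] r'(2) P(1)] .
      ultimately have "r = r'" using par_on_line[OF C2(1)] by blast
      then show ?thesis using r r' by blast
    qed
  qed
qed

end

section \<open>From perspective triangles to labelled vertices\<close>

context dual_net
begin

lemma vertical_line_eq:
  assumes "V \<in> vertical_lines P L" "x \<in> V"
  shows "V = {y \<in> P. par x y}"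
proof -
  obtain z where z: "z \<in> P" "V = {y \<in> P. par z y}"
    using assms(1) unfolding vertical_lines_def quotient_def par_def by auto
  then have "x \<in> P" "par z x" using assms by auto
  then have "par z y \<longleftrightarrow> par x y" for y
    using par_trans[of z x y] par_trans[of x z y] par_sym[of z x] z(1) by blast
  then show ?thesis using z by blast
qed

text \<open>Each vertex is named after the opposite side.\<close>

lemma triangle_cases:
  assumes "triangle L {A, B, C}"
  obtains a b c where "A \<in> L" "B \<in> L" "C \<in> L" "A \<noteq> B" "A \<noteq> C" "B \<noteq> C"
    "a \<in> B" "a \<in> C" "b \<in> A" "b \<in> C" "c \<in> A" "c \<in> B" "a \<noteq> b" "a \<noteq> c" "b \<noteq> c"
    "vertices {A, B, C} = {a, b, c}"
proof -
  have L: "A \<in> L" "B \<in> L" "C \<in> L" and 3: "card {A, B, C} = 3" "card (vertices {A, B, C}) = 3"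
    and meet: "\<And>X Y. \<lbrakk>X \<in> {A, B, C}; Y \<in> {A, B, C}; X \<noteq> Y\<rbrakk> \<Longrightarrow> \<exists>z. z \<in> X \<and> z \<in> Y"
    using assms unfolding triangle_def by auto
  have d: "A \<noteq> B" "A \<noteq> C" "B \<noteq> C" using 3(1) by (auto simp: card_insert_if split: if_splits)
  obtain a b c where abc: "a \<in> B" "a \<in> C" "b \<in> A" "b \<in> C" "c \<in> A" "c \<in> B"
    using meet d by (metis insertI1 insertI2)
  have "z = a" if "z \<in> B" "z \<in> C" for z using that meet_eqI[of B C] L d abc by blast
  moreover have "z = b" if "z \<in> A" "z \<in> C" for z using that meet_eqI[of A C] L d abc by blast
  moreover have "z = c" if "z \<in> A" "z \<in> B" for z using that meet_eqI[of A B] L d abc by blast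
  ultimately have v: "vertices {A, B, C} = {a, b, c}"
    unfolding vertices_def using d abc by blast
  then have "a \<noteq> b" "a \<noteq> c" "b \<noteq> c" using 3(2) by (auto simp: card_insert_if split: if_splits)
  then show thesis using that L d abc v by blast
qed

text \<open>Choosing a vertex of \<open>T\<close> on each of the three lines of \<open>W\<close> is
  injective, since vertical lines with a common point are equal. With three vertices it is onto, so
  \<open>v\<close> lies on a line of \<open>W\<close>, which also carries a vertex of
  \<open>T'\<close>.\<close>

lemma perspective_partner:
  assumes "in_perspective P L T T'" and v: "v \<in> vertices T"
  shows "\<exists>v'. corresponding_vertices P L T T' v v' \<and> par v v'"
proof -
  have t: "card (vertices T) = 3"
    using assms(1) by (simp add: in_perspective_def triangle_def)
  obtain W where W: "W \<subseteq> vertical_lines P L" "card W = 3"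
    and uu: "\<forall>V\<in>W. (\<exists>!v. v \<in> vertices T \<and> v \<in> V) \<and> (\<exists>!v. v \<in> vertices T' \<and> v \<in> V)"
    using assms(1) unfolding in_perspective_def by (elim conjE exE) (rule that)
  have u: "\<exists>v. v \<in> vertices T \<and> v \<in> V" and u': "\<exists>v. v \<in> vertices T' \<and> v \<in> V" if "V \<in> W" for V
    using bspec[OF uu that] by (elim conjE, elim ex1_implies_ex)+
  obtain f where f: "\<And>V. V \<in> W \<Longrightarrow> f V \<in> vertices T \<and> f V \<in> V" using u by metis
  have inj: "inj_on f W"
  proof
    fix V V' assume "V \<in> W" "V' \<in> W" "f V = f V'"
    then show "V = V'"
      using f[of V] f[of V'] vertical_line_eq[of V "f V"] vertical_line_eq[of V' "f V"] W by auto
  qed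
  have "f ` W = vertices T"
    by (rule card_subset_eq) (use f t W card_image[OF inj] card.infinite[of "vertices T"] in auto)
  then obtain V where "V \<in> W" "v = f V" using v by (metis imageE)
  then have V: "V \<in> W" "v \<in> V" using f by simp_all
  obtain v' where v': "v' \<in> vertices T'" "v' \<in> V" using u'[OF V(1)] by blast
  have VV: "V \<in> vertical_lines P L" using V W by blast
  then have "par v v'" using vertical_line_eq[OF VV V(2)] v' by blast
  then show ?thesis unfolding corresponding_vertices_def using v v' V VV by blast
qed

end

theorem theorem1:
  fixes P :: "'p set" and L :: "'p set set"
  assumes "dual_net P L"
    and "\<not> dual_affine_plane P L"
    and "VY L"
  shows "LD P L"
  unfolding LD_def
proof (intro allI impI, elim conjE)
  interpret dual_net P L by fact
  fix A B C A' B' C' V p q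
  assume persp: "in_perspective P L {A, B, C} {A', B', C'}"
    and sides: "corresponding_sides P L {A, B, C} {A', B', C'} A A'"
      "corresponding_sides P L {A, B, C} {A', B', C'} B B'"
      "corresponding_sides P L {A, B, C} {A', B', C'} C C'"
    and V: "V \<in> vertical_lines P L" "p \<in> V" "q \<in> V"
    and pq: "p \<noteq> q" "p \<in> A" "p \<in> A'" "q \<in> B" "q \<in> B'"
  have Veq: "V = {y \<in> P. par p y}" using vertical_line_eq V by blast
  then have pq_par: "par p q" using V by blast
  have "triangle L {A, B, C}" "triangle L {A', B', C'}"
    using persp by (auto simp: in_perspective_def)
  then obtain a b c a' b' c' where
    L: "A \<in> L" "B \<in> L" "C \<in> L" "A \<noteq> B" "A \<noteq> C" "B \<noteq> C" and
    abc: "a \<in> B" "a \<in> C" "b \<in> A" "b \<in> C" "c \<in> A" "c \<in> B" "a \<noteq> b" "a \<noteq> c" "b \<noteq> c" and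
    v: "vertices {A, B, C} = {a, b, c}" and
    L': "A' \<in> L" "B' \<in> L" "C' \<in> L" "A' \<noteq> B'" "A' \<noteq> C'" "B' \<noteq> C'" and
    abc': "a' \<in> B'" "a' \<in> C'" "b' \<in> A'" "b' \<in> C'" "c' \<in> A'" "c' \<in> B'" "a' \<noteq> b'" "a' \<noteq> c'" "b' \<noteq> c'" and
    v': "vertices {A', B', C'} = {a', b', c'}"
    by (elim triangle_cases)
  have off: "a \<notin> A" "b \<notin> B" "c \<notin> C" "a' \<notin> A'" "b' \<notin> B'" "c' \<notin> C'"
    using meet_eqI[OF L(1,2,4)] meet_eqI[OF L(1,3,5)] meet_eqI[OF L'(1,2,4)] meet_eqI[OF L'(1,3,5)]
      abc abc' by blast+
  have side: "x \<in> A \<longleftrightarrow> x' \<in> A'" "x \<in> B \<longleftrightarrow> x' \<in> B'" "x \<in> C \<longleftrightarrow> x' \<in> C'" "x' \<in> {a', b', c'}"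
    if "corresponding_vertices P L {A, B, C} {A', B', C'} x x'" for x x'
    using sides that v' by (simp_all add: corresponding_sides_def corresponding_vertices_def[of _ _ _ _ x x'])
  have partner: "\<exists>x'\<in>{a', b', c'}. (x \<in> A \<longleftrightarrow> x' \<in> A') \<and> (x \<in> B \<longleftrightarrow> x' \<in> B') \<and> (x \<in> C \<longleftrightarrow> x' \<in> C') \<and> par x x'"
    if "x \<in> {a, b, c}" for x
    using perspective_partner[OF persp, of x] that side unfolding v by blast
  \<comment> \<open>A vertex is determined by the side that misses it, so corresponding sides force
    the matching of the labels.\<close>
  have par: "par a a'" "par b b'" "par c c'"
    using partner[of a] partner[of b] partner[of c] off abc abc' by auto
  have "a \<in> P" "b \<in> P" "c \<in> P" using in_P L abc by blast+
  moreover have "\<not> par a b" "\<not> par a c" "\<not> par b c"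
    using par_on_line[OF L(3), of a b] par_on_line[OF L(2), of a c] par_on_line[OF L(1), of b c] abc
    by blast+
  \<comment> \<open>The vertices of the given triangle serve as the three mutually nonparallel
    points.\<close>
  ultimately interpret vy_net P L
    by (intro vy_net.intro vy_net_axioms.intro dual_net_axioms \<open>VY L\<close>) blast
  obtain X Y where "X \<in> L" "Y \<in> L" "X \<inter> Y = {}"
    using assms(1,2) unfolding dual_affine_plane_def by blast
  then obtain r where "r \<in> C" "r \<in> C'" "par p r"
    using desargues[OF _ _ _ L(1-5) abc(1-7,9) L'(1-5) abc'(1-7,9) par pq(2-5,1) pq_par] by blast
  then show "\<exists>r\<in>V. r \<in> C \<and> r \<in> C'" using Veq in_P L by blast
qed

end
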